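(* Let $G$ be a finite group, let $V$ be a finite-dimensional complex inner product space, and let $\rho : G \to \mathsf{U}(V)$ be an irreducible representation of $G$ of dimension $d_\rho = \dim V$. Let $\Pi : V \to V$ be the (orthogonal) projection operator onto a $d_\psi$-dimensional subspace $W \subseteq V$, where $d_\psi \ge 1$. If we define $$\psi(x) = \sqrt{\frac{d_\rho}{d_\psi}}\; \Pi\,\rho(x)\,\Pi \qquad (x \in G),$$ then $\mathbb{E}_x \psi(x) = 0$, $\mathbb{E}_x \psi(x)^\dagger \psi(x) = \Pi$, and $$\mathbb{E}_{x,y\in G} \left\| \psi(xy) - \psi(x)\,\psi(y) \right\|_{\mathrm F}^2 = 2 d_\psi \left( 1 - \sqrt{\frac{d_\psi}{d_\rho}} \right).$$
   Context: $\mathsf{U}(V)$ is the group of unitary operators on $V$. $\mathbb{E}_x$ and $\mathbb{E}_{x,y}$ denote averages over $x \in G$, respectively over independent pairs $(x,y)\in G\times G$, chosen uniformly at random. $A^\dagger$ denotes the adjoint of $A$, and $\|A\|_{\mathrm F}^2 = \operatorname{tr} A^\dagger A$ is the squared Frobenius norm.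
   Formalization: The claim E_x ψ(x) = 0 is proved only when ρ is not the trivial representation; for trivial ρ (V one-dimensional, W = V) one has ψ(x) = 1 and the average is 1, so it fails. The other two identities are proved for every irreducible ρ. *)

theory Defs
  imports Complex_Main "HOL-Algebra.Group"
begin

(* Basis is an arbitrary vector space basis, inherited from the library locale for finite
   dimension; it need not be orthonormal. *)
locale fin_dim_complex_inner_space =
  finite_dimensional_vector_space scale Basis
  for scale :: "complex \<Rightarrow> 'v::ab_group_add \<Rightarrow> 'v" (infixr \<open>*s\<close> 75)
    and Basis :: "'v set" +
  fixes cinner :: "'v \<Rightarrow> 'v \<Rightarrow> complex"
  assumes cinner_commute: "cinner x y = cnj (cinner y x)"
    and cinner_add_right: "cinner x (y + z) = cinner x y + cinner x z"
    and cinner_scale_right: "cinner x (c *s y) = c * cinner x y"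
    and cinner_pos: "x \<noteq> 0 \<Longrightarrow> 0 < Re (cinner x x)"
begin

abbreviation operator :: "('v \<Rightarrow> 'v) \<Rightarrow> bool"
  where "operator A \<equiv> Vector_Spaces.linear scale scale A"

definition unitary_group :: "('v \<Rightarrow> 'v) monoid"
  where "unitary_group =
    \<lparr>carrier = {U. operator U \<and> surj U \<and> (\<forall>v w. cinner (U v) (U w) = cinner v w)},
     mult = (\<circ>), one = id\<rparr>"

definition unitary_rep :: "('g, 'b) monoid_scheme \<Rightarrow> ('g \<Rightarrow> 'v \<Rightarrow> 'v) \<Rightarrow> bool"
  where "unitary_rep G \<rho> \<longleftrightarrow> \<rho> \<in> hom G unitary_group"

definition irreducible_rep :: "('g, 'b) monoid_scheme \<Rightarrow> ('g \<Rightarrow> 'v \<Rightarrow> 'v) \<Rightarrow> bool"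
  where "irreducible_rep G \<rho> \<longleftrightarrow> (UNIV :: 'v set) \<noteq> {0} \<and>
    (\<forall>S. subspace S \<and> (\<forall>g\<in>carrier G. \<rho> g ` S \<subseteq> S) \<longrightarrow> S = {0} \<or> S = UNIV)"

(* Used for a subspace W; linearity, idempotence and self-adjointness of P then follow. *)
definition orthogonal_projection_onto :: "'v set \<Rightarrow> ('v \<Rightarrow> 'v) \<Rightarrow> bool"
  where "orthogonal_projection_onto W P \<longleftrightarrow>
    (\<forall>v. P v \<in> W \<and> (\<forall>w\<in>W. cinner w (v - P v) = 0))"

(* For linear A such a B exists and is unique, by finite dimension. *)
definition adjoint_op :: "('v \<Rightarrow> 'v) \<Rightarrow> 'v \<Rightarrow> 'v"
  where "adjoint_op A = (THE B. operator B \<and> (\<forall>v w. cinner (B v) w = cinner v (A w)))"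

definition trace_op :: "('v \<Rightarrow> 'v) \<Rightarrow> complex"
  where "trace_op A = (\<Sum>b\<in>Basis. representation Basis (A b) b)"

(* The trace is real and nonnegative here, so Re only changes the type. *)
definition frobenius_sq :: "('v \<Rightarrow> 'v) \<Rightarrow> real"
  where "frobenius_sq A = Re (trace_op (adjoint_op A \<circ> A))"

definition mean_op :: "'i set \<Rightarrow> ('i \<Rightarrow> 'v \<Rightarrow> 'v) \<Rightarrow> 'v \<Rightarrow> 'v"
  where "mean_op I F = (\<lambda>v. (1 / of_nat (card I)) *s (\<Sum>i\<in>I. F i v))"

end

definition mean :: "'i set \<Rightarrow> ('i \<Rightarrow> real) \<Rightarrow> real"
  where "mean I f = (\<Sum>i\<in>I. f i) / real (card I)"

end

(* By Schur's lemma the conjugation average of an operator A over G is (tr A / d_rho) I, so with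
   s = sqrt (d_rho / d_psi) the average over x of s^2 rho(x)^-1 P rho(x) is the identity. Since
   psi(x)^dagger = psi(x^-1), averaging psi(x)^dagger psi(x) gives P. Expanding D^dagger D for the
   defect D = psi(xy) - psi(x) psi(y) gives four terms; averaged over x and then y, the two diagonal
   terms contribute P each and the two cross terms -P/s each, and tr P = d_psi. The eigenvalue for
   Schur's lemma is found algebraically: a nonzero polynomial p of least degree with p(T) v = 0 has a
   root a, and if p = (X - a) q then q(T) v is an eigenvector. *)

theory Submission
  imports Defs "HOL-Computational_Algebra.Fundamental_Theorem_Algebra"
begin

context fin_dim_complex_inner_space
begin

section \<open>Linear operators\<close>

lemmas operator_simps =
  module_hom.add[OF Vector_Spaces.linear.axioms(3)[of scale scale]]
  module_hom.scale[OF Vector_Spaces.linear.axioms(3)[of scale scale]]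
  module_hom.diff[OF Vector_Spaces.linear.axioms(3)[of scale scale]]
  module_hom.zero[OF Vector_Spaces.linear.axioms(3)[of scale scale]]
  module_hom.sum[OF Vector_Spaces.linear.axioms(3)[of scale scale]]

lemma operatorI:
  assumes "\<And>x y. A (x + y) = A x + A y" and "\<And>c x. A (c *s x) = c *s A x"
  shows "operator A"
  by (intro Vector_Spaces.linear.intro module_hom.intro module_hom_axioms.intro
      vector_space_axioms module_axioms assms)

lemma operator_comp: "operator A \<Longrightarrow> operator B \<Longrightarrow> operator (\<lambda>v. A (B v))"
  by (rule operatorI) (simp_all add: operator_simps)

lemma operator_scale: "operator A \<Longrightarrow> operator (\<lambda>v. c *s A v)"
  by (rule operatorI) (simp_all add: operator_simps scale_right_distrib mult.commute)

lemma operator_diff: "operator A \<Longrightarrow> operator B \<Longrightarrow> operator (\<lambda>v. A v - B v)"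
  by (rule operatorI) (simp_all add: operator_simps scale_right_diff_distrib)

lemma operator_sum:
  assumes "\<And>i. i \<in> I \<Longrightarrow> operator (A i)"
  shows "operator (\<lambda>v. \<Sum>i\<in>I. A i v)"
  by (rule operatorI)
    (simp_all add: operator_simps(1,2)[OF assms] sum.distrib scale_sum_right)

subsection \<open>Eigenvalues\<close>

text \<open>The vector p(T) v. Only the orbit of a single vector matters, so p(T) is not formed as
  an operator.\<close>

definition poly_orbit :: "('v \<Rightarrow> 'v) \<Rightarrow> 'v \<Rightarrow> complex poly \<Rightarrow> 'v"
  where "poly_orbit T v p = (\<Sum>i\<le>degree p. coeff p i *s (T ^^ i) v)"

text \<open>Coefficients above the degree vanish, so polynomials of different degrees can be brought
  to a common summation range.\<close>

lemma poly_orbit_le: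
  assumes "degree p \<le> n"
  shows "poly_orbit T v p = (\<Sum>i\<le>n. coeff p i *s (T ^^ i) v)"
  unfolding poly_orbit_def
  by (rule sum.mono_neutral_left) (use assms in \<open>auto simp: coeff_eq_0\<close>)

text \<open>Multiplication by X shifts the coefficients by one, which amounts to one more
  application of \<open>T\<close>.\<close>

lemma poly_orbit_linear_factor:
  assumes "operator T"
  shows "poly_orbit T v ([:- a, 1:] * q) = T (poly_orbit T v q) - a *s poly_orbit T v q"
proof -
  let ?n = "degree q"
  let ?t = "\<lambda>i. (T ^^ i) v"
  have eq: "[:- a, 1:] * q = pCons 0 q - smult a q" by simp
  have "degree ([:- a, 1:] * q) \<le> Suc ?n"
    using degree_mult_le[of "[:- a, 1:]" q] by simp
  then have "poly_orbit T v ([:- a, 1:] * q)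
      = (\<Sum>i\<le>Suc ?n. coeff ([:- a, 1:] * q) i *s ?t i)"
    by (rule poly_orbit_le)
  also have "\<dots> = (\<Sum>i\<le>Suc ?n. coeff (pCons 0 q) i *s ?t i) - (\<Sum>i\<le>Suc ?n. (a * coeff q i) *s ?t i)"
    unfolding eq coeff_diff coeff_smult scale_left_diff_distrib sum_subtractf ..
  \<comment> \<open>The polynomial \<open>pCons 0 q\<close> is X q: its term at index 0 vanishes,
    and \<open>T\<close> factors out of the rest.\<close>
  also have "(\<Sum>i\<le>Suc ?n. coeff (pCons 0 q) i *s ?t i) = T (poly_orbit T v q)"
    unfolding sum.atMost_Suc_shift poly_orbit_def
    by (simp add: operator_simps[OF assms])
  also have "(\<Sum>i\<le>Suc ?n. (a * coeff q i) *s ?t i) = a *s poly_orbit T v q"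
    by (simp add: poly_orbit_le[of q "Suc ?n"] scale_sum_right scale_right_distrib del: sum.atMost_Suc)
  finally show ?thesis .
qed

text \<open>The vectors v, T v, ..., T^n v with n = \<open>card Basis\<close> are one more than the
  dimension, and a linear relation among them supplies the coefficients. Dependence is a property of
  sets and does not see repetitions, hence the case split on injectivity.\<close>

lemma poly_orbit_annihilator: "\<exists>p. p \<noteq> 0 \<and> poly_orbit T v p = 0"
proof -
  let ?t = "\<lambda>i. (T ^^ i) v"
  let ?n = "card Basis"
  show ?thesis
  proof (cases "inj_on ?t {..?n}")
    case False
    then obtain i j where ij: "i \<noteq> j" "i \<le> ?n" "j \<le> ?n" "?t i = ?t j"
      by (auto simp: inj_on_def)
    \<comment> \<open>A repeated iterate is itself a relation, given by X^i - X^j.\<close>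
    let ?p = "monom 1 i - monom 1 j :: complex poly"
    have "coeff ?p i = 1" using ij by simp
    then have "?p \<noteq> 0" by (metis coeff_0 zero_neq_one)
    moreover have "degree ?p \<le> ?n"
      using ij by (intro degree_diff_le) (auto intro: order.trans[OF degree_monom_le])
    then have "poly_orbit T v ?p = ?t i - ?t j"
      using ij by (simp add: poly_orbit_le[where n = ?n] scale_left_diff_distrib sum_subtractf
          if_distrib[of "\<lambda>c. c *s _"] cong: if_cong)
    then have "poly_orbit T v ?p = 0" using ij(4) by simp
    ultimately show ?thesis by blast
  next
    case True
    have "dependent (?t ` {..?n})"
      using independent_card_le_dim[of "?t ` {..?n}" UNIV] card_image[OF True]
      by (auto simp: dim_UNIV dimension_def)
    then obtain u where u: "(\<Sum>w\<in>?t ` {..?n}. u w *s w) = 0" "\<exists>w\<in>?t ` {..?n}. u w \<noteq> 0"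
      by (auto simp: dependent_finite)
    define p where "p = (\<Sum>i\<le>?n. monom (u (?t i)) i)"
    have cp: "coeff p i = (if i \<le> ?n then u (?t i) else 0)" for i
      by (auto simp: p_def coeff_sum)
    obtain i where "i \<le> ?n" "u (?t i) \<noteq> 0" using u(2) by auto
    then have "coeff p i \<noteq> 0" by (simp add: cp)
    then have "p \<noteq> 0" by auto
    moreover have "degree p \<le> ?n" by (rule degree_le) (simp add: cp)
    then have "poly_orbit T v p = (\<Sum>i\<le>?n. u (?t i) *s ?t i)"
      by (simp add: poly_orbit_le[where n = ?n] cp)
    then have "poly_orbit T v p = 0"
      using u(1) sum.reindex[OF True, of "\<lambda>w. u w *s w"] by (simp add: o_def)
    ultimately show ?thesis by blast
  qed
qed

text \<open>An annihilating polynomial of least degree for the orbit of v plays the role of the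
  characteristic polynomial.\<close>

lemma eigenvector_exists:
  assumes T: "operator T" and v: "(v :: 'v) \<noteq> 0"
  shows "\<exists>a u. u \<noteq> 0 \<and> T u = a *s u"
proof -
  let ?Q = "\<lambda>p. p \<noteq> 0 \<and> poly_orbit T v p = 0"
  obtain p where p: "?Q p" and min: "\<And>q. ?Q q \<Longrightarrow> degree p \<le> degree q"
    using ex_has_least_nat[of ?Q _ degree] poly_orbit_annihilator[of T v] by metis
  \<comment> \<open>A nonzero constant c would give c v = 0 with v nonzero; so \<open>p\<close> has
    a root.\<close>
  have "degree p \<noteq> 0"
  proof
    assume d: "degree p = 0"
    then have "coeff p 0 \<noteq> 0" using p leading_coeff_0_iff[of p] by simp
    moreover have "coeff p 0 *s v = 0" using p d by (simp add: poly_orbit_def)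
    ultimately show False using v by simp
  qed
  then obtain a where "poly p a = 0"
    using fundamental_theorem_of_algebra[of p] constant_degree[of p] by auto
  then obtain q where q: "p = [:- a, 1:] * q"
    by (metis poly_eq_0_iff_dvd dvdE)
  \<comment> \<open>Minimality of \<open>p\<close> keeps q(T) v away from 0.\<close>
  have "q \<noteq> 0" using p q by auto
  then have "degree q < degree p" using q by (simp add: degree_mult_eq del: mult_pCons_left)
  then have "poly_orbit T v q \<noteq> 0" using min[of q] \<open>q \<noteq> 0\<close> by auto
  moreover have "T (poly_orbit T v q) = a *s poly_orbit T v q"
    using poly_orbit_linear_factor[OF T, of v a q] p q by simp
  ultimately show ?thesis by blast
qed

subsection \<open>Trace and adjoint\<close>

lemma trace_op_sum: "trace_op (\<lambda>v. \<Sum>i\<in>I. F i v) = (\<Sum>i\<in>I. trace_op (F i))"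
  unfolding trace_op_def
  by (subst sum.swap) (simp add: representation_sum independent_Basis span_Basis)

lemma trace_op_scale: "trace_op (\<lambda>v. c *s A v) = c * trace_op A"
  unfolding trace_op_def
  by (simp add: representation_scale independent_Basis span_Basis sum_distrib_left)

lemma trace_op_scaling: "trace_op (\<lambda>v. c *s v) = c * of_nat (dim (UNIV :: 'v set))"
  unfolding trace_op_scale
  by (simp add: trace_op_def representation_basis independent_Basis dim_UNIV dimension_def)

lemma sum_representation_Basis: "(\<Sum>b\<in>Basis. representation Basis v b *s b) = v"
  by (rule sum_representation_eq) (auto simp: independent_Basis span_Basis finite_Basis)

text \<open>In coordinates both traces are the same double sum of products of matrix entries, with
  the two indices exchanged.\<close>

lemma trace_op_commute:
  assumes "operator A" and "operator B"
  shows "trace_op (\<lambda>v. A (B v)) = trace_op (\<lambda>v. B (A v))"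
proof -
  have *: "trace_op (\<lambda>v. C (D v))
      = (\<Sum>e\<in>Basis. \<Sum>f\<in>Basis. representation Basis (D e) f * representation Basis (C f) e)"
    if C: "operator C" for C D
  proof -
    have "C (D e) = (\<Sum>f\<in>Basis. representation Basis (D e) f *s C f)" for e
      by (subst sum_representation_Basis[of "D e", symmetric]) (simp only: operator_simps[OF C])
    then show ?thesis
      by (simp add: trace_op_def representation_sum representation_scale independent_Basis span_Basis)
  qed
  show ?thesis
    unfolding *[OF assms(1)] *[OF assms(2)]
    by (subst sum.swap) (simp add: mult.commute)
qed

text \<open>\<open>Basis\<close> need not be adapted to \<open>W\<close>, so \<open>P\<close> is
  split along a basis \<open>B\<close> of \<open>W\<close> into rank-one operators, each of trace
  1.\<close>

lemma trace_op_idempotent: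
  assumes P: "operator P" and W: "subspace W" and PW: "\<And>v. P v \<in> W" and Pid: "\<And>w. w \<in> W \<Longrightarrow> P w = w"
  shows "trace_op P = of_nat (dim W)"
proof -
  obtain B where B: "B \<subseteq> W" "independent B" "span B = W" "card B = dim W"
    using basis_exists[of W] W by (metis span_minimal subset_antisym)
  have fin: "finite B" using B(2) by (rule finiteI_independent)
  let ?r = "\<lambda>v. representation B (P v)"
  \<comment> \<open>The trace of v \<mapsto> f(v) b is f(b), seen by expanding b in
    \<open>Basis\<close>.\<close>
  have rank1: "trace_op (\<lambda>v. ?r v b *s b) = ?r b b" for b
  proof -
    have "?r b b = ?r (\<Sum>e\<in>Basis. representation Basis b e *s e) b"
      by (simp only: sum_representation_Basis)
    also have "\<dots> = (\<Sum>e\<in>Basis. representation Basis b e * ?r e b)"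
      using B PW by (simp add: operator_simps[OF P] representation_sum representation_scale
          subspace_scale[OF W])
    finally show ?thesis
      by (simp add: trace_op_def representation_scale independent_Basis span_Basis mult.commute)
  qed
  have "P v = (\<Sum>b\<in>B. ?r v b *s b)" for v
    by (rule sum_representation_eq[symmetric]) (use B PW fin in auto)
  then have "trace_op P = trace_op (\<lambda>v. \<Sum>b\<in>B. ?r v b *s b)" by metis
  also have "\<dots> = (\<Sum>b\<in>B. ?r b b)" by (simp add: trace_op_sum rank1)
  also have "\<dots> = (\<Sum>b\<in>B. 1)"
    by (rule sum.cong) (use B Pid in \<open>auto simp: representation_basis\<close>)
  finally show ?thesis using B by simp
qed

section \<open>Inner product and adjoints\<close>

lemma cinner_add_left: "cinner (x + y) z = cinner x z + cinner y z"
  by (metis cinner_commute cinner_add_right complex_cnj_add)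

lemma cinner_scale_left: "cinner (c *s x) z = cnj c * cinner x z"
  by (metis cinner_commute cinner_scale_right complex_cnj_mult)

lemma cinner_diff_right: "cinner x (y - z) = cinner x y - cinner x z"
  by (metis cinner_add_right add_diff_cancel diff_add_cancel)

lemma cinner_diff_left: "cinner (x - y) z = cinner x z - cinner y z"
  by (metis cinner_add_left add_diff_cancel diff_add_cancel)

lemma cinner_eqI:
  assumes "\<And>w. cinner x w = cinner y w" shows "x = y"
proof -
  have "cinner (x - y) (x - y) = 0" using assms by (simp add: cinner_diff_left)
  then show ?thesis using cinner_pos[of "x - y"] by (metis eq_iff_diff_eq_0 less_irrefl zero_complex.sel(1))
qed

text \<open>Nondegeneracy makes adjoints unique, so an explicit candidate determines the description
  in \<open>adjoint_op\<close>.\<close>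

lemma adjoint_op_eqI:
  assumes "operator B" and "\<And>v w. cinner (B v) w = cinner v (A w)"
  shows "adjoint_op A = B"
  unfolding adjoint_op_def
  by (rule the_equality) (use assms in \<open>auto intro!: ext cinner_eqI\<close>)

section \<open>Orthogonal projections\<close>

context
  fixes W P
  assumes W: "subspace W" and P: "orthogonal_projection_onto W P"
begin

lemma projection_in: "P v \<in> W"
  using P by (simp add: orthogonal_projection_onto_def)

lemma projection_orth: "w \<in> W \<Longrightarrow> cinner w (P v) = cinner w v"
  using P unfolding orthogonal_projection_onto_def by (metis cinner_diff_right eq_iff_diff_eq_0)

text \<open>Both \<open>P v\<close> and \<open>P w\<close> lie in \<open>W\<close>, so each side
  equals \<open>cinner (P v) (P w)\<close>.\<close>

lemma projection_self_adjoint: "cinner (P v) w = cinner v (P w)"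
  by (metis projection_in projection_orth cinner_commute)

text \<open>Self-adjointness moves \<open>P\<close> to the other argument, where linearity of the
  inner product takes over.\<close>

lemma projection_operator: "operator P"
  by (rule operatorI; rule cinner_eqI)
    (simp_all add: projection_self_adjoint cinner_add_left cinner_scale_left)

lemma projection_id:
  assumes "w \<in> W" shows "P w = w"
proof (rule cinner_eqI)
  fix u
  show "cinner (P w) u = cinner w u"
    using projection_self_adjoint[of w u] projection_orth[OF assms, of u] by simp
qed

lemma trace_projection: "trace_op P = of_nat (dim W)"
  by (rule trace_op_idempotent[OF projection_operator W projection_in projection_id])

end

end

subsection \<open>Irreducible unitary representations\<close>

locale irreducible_unitary_rep =
  fin_dim_complex_inner_space scale Basis cinner + group G
  for scale :: "complex \<Rightarrow> 'v::ab_group_add \<Rightarrow> 'v" (infixr \<open>*s\<close> 75)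
    and Basis :: "'v set" and cinner :: "'v \<Rightarrow> 'v \<Rightarrow> complex"
    and G :: "('g, 'b) monoid_scheme" (structure) +
  fixes \<rho> :: "'g \<Rightarrow> 'v \<Rightarrow> 'v"
  assumes fin: "finite (carrier G)"
    and rep: "unitary_rep G \<rho>"
    and irred: "irreducible_rep G \<rho>"
begin

lemma rep_unitary:
  assumes "x \<in> carrier G"
  shows rep_operator: "operator (\<rho> x)" and rep_surj: "surj (\<rho> x)"
    and rep_cinner: "cinner (\<rho> x v) (\<rho> x w) = cinner v w"
  using assms rep by (auto simp: unitary_rep_def hom_def unitary_group_def Pi_iff)

lemma rep_mult: "x \<in> carrier G \<Longrightarrow> y \<in> carrier G \<Longrightarrow> \<rho> (x \<otimes> y) v = \<rho> x (\<rho> y v)"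
  using rep by (auto simp: unitary_rep_def hom_def unitary_group_def)

text \<open>Elements of \<open>hom\<close> are only required to be multiplicative. The image of the
  unit is idempotent and surjective, hence the identity.\<close>

lemma rep_one: "\<rho> \<one> v = v"
  using rep_mult[of \<one> \<one>] rep_surj[of \<one>] by (metis one_closed r_one surjD)

lemma rep_inv:
  assumes "x \<in> carrier G"
  shows "\<rho> (inv x) (\<rho> x v) = v" and "\<rho> x (\<rho> (inv x) v) = v"
  using assms rep_mult[of x "inv x" v] rep_mult[of "inv x" x v] by (simp_all add: rep_one)

lemma rep_adjoint: "x \<in> carrier G \<Longrightarrow> cinner (\<rho> (inv x) v) w = cinner v (\<rho> x w)"
  by (metis rep_cinner rep_inv(2))

lemma sum_translate:
  assumes "g \<in> carrier G"
  shows "(\<Sum>x\<in>carrier G. f (x \<otimes> g)) = (\<Sum>x\<in>carrier G. f x)"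
  by (rule sum.reindex_bij_witness[of _ "\<lambda>x. x \<otimes> inv g" "\<lambda>x. x \<otimes> g"])
    (use assms in \<open>auto simp: m_assoc\<close>)

lemma irreducible_cases:
  assumes "subspace S" and "\<And>g v. g \<in> carrier G \<Longrightarrow> v \<in> S \<Longrightarrow> \<rho> g v \<in> S"
  shows "S = {0} \<or> S = UNIV"
  using assms irred unfolding irreducible_rep_def by (metis image_subsetI)

text \<open>Commutation makes an eigenspace of \<open>T\<close> invariant; it is nonzero, so
  irreducibility makes it the whole space.\<close>

lemma schur:
  assumes T: "operator T"
    and comm: "\<And>g v. g \<in> carrier G \<Longrightarrow> T (\<rho> g v) = \<rho> g (T v)"
  shows "\<exists>a. \<forall>v. T v = a *s v"
proof -
  obtain v :: 'v where "v \<noteq> 0" using irred by (auto simp: irreducible_rep_def)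
  then obtain a u where u: "u \<noteq> 0" "T u = a *s u" using eigenvector_exists[OF T] by blast
  let ?S = "{u. T u = a *s u}"
  have "subspace ?S"
    by (rule subspaceI) (auto simp: operator_simps[OF T] scale_right_distrib scale_left_commute)
  then have "?S = {0} \<or> ?S = UNIV"
    by (rule irreducible_cases) (auto simp: comm operator_simps[OF rep_operator])
  then show ?thesis using u by blast
qed

text \<open>The sum is a fixed vector, and the fixed vectors form an invariant subspace. The premise
  excludes that this is the whole space, where the sum would be a nonzero multiple of
  \<open>v\<close>.\<close>

lemma sum_rep_eq_0:
  assumes "\<exists>g\<in>carrier G. \<rho> g \<noteq> id"
  shows "(\<Sum>x\<in>carrier G. \<rho> x v) = 0"
proof -
  let ?S = "{u. \<forall>g\<in>carrier G. \<rho> g u = u}"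
  have "subspace ?S" by (rule subspaceI) (auto simp: operator_simps[OF rep_operator])
  then have "?S = {0} \<or> ?S = UNIV" by (rule irreducible_cases) auto
  moreover have "?S \<noteq> UNIV" using assms by (auto simp: fun_eq_iff)
  moreover have "(\<Sum>x\<in>carrier G. \<rho> x v) \<in> ?S"
  proof (clarify)
    fix g assume g: "g \<in> carrier G"
    have "\<rho> g (\<Sum>x\<in>carrier G. \<rho> x v) = (\<Sum>x\<in>carrier G. \<rho> (g \<otimes> x) v)"
      using g by (simp add: operator_simps[OF rep_operator] rep_mult)
    also have "\<dots> = (\<Sum>x\<in>carrier G. \<rho> x v)"
      by (rule sum.reindex_bij_witness[of _ "\<lambda>x. inv g \<otimes> x" "\<lambda>x. g \<otimes> x"])
        (use g in \<open>auto simp: m_assoc[symmetric]\<close>)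
    finally show "\<rho> g (\<Sum>x\<in>carrier G. \<rho> x v) = (\<Sum>x\<in>carrier G. \<rho> x v)" .
  qed
  ultimately show ?thesis by blast
qed

lemma dim_UNIV_nonzero: "dim (UNIV :: 'v set) \<noteq> 0"
proof
  assume "dim (UNIV :: 'v set) = 0"
  then have "Basis = {}" using finite_Basis by (simp add: dim_UNIV dimension_def)
  then have "(UNIV :: 'v set) = {0}" using span_Basis by simp
  then show False using irred by (simp add: irreducible_rep_def)
qed

text \<open>The sum commutes with the representation, so Schur's lemma makes it a scalar; comparing
  traces determines the scalar.\<close>

lemma sum_conjugates:
  assumes A: "operator A"
  shows "(\<Sum>x\<in>carrier G. \<rho> (inv x) (A (\<rho> x v)))
    = (of_nat (card (carrier G)) * trace_op A / of_nat (dim (UNIV :: 'v set))) *s v"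
proof -
  let ?c = "\<lambda>x v. \<rho> (inv x) (A (\<rho> x v))"
  let ?T = "\<lambda>v. \<Sum>x\<in>carrier G. ?c x v"
  have T: "operator ?T"
    by (intro operator_sum operator_comp[OF rep_operator operator_comp[OF A rep_operator]]) auto
  have "?T (\<rho> g v) = \<rho> g (?T v)" if g: "g \<in> carrier G" for g v
  proof -
    \<comment> \<open>After replacing x by x g, the outer \<open>\<rho> g\<close> cancels against
      the factor of g in the inverse of x g.\<close>
    have "\<rho> g (?T v) = \<rho> g (\<Sum>x\<in>carrier G. ?c (x \<otimes> g) v)"
      by (simp only: sum_translate[OF g, of "\<lambda>x. ?c x v"])
    also have "\<dots> = ?T (\<rho> g v)"
      using g by (simp add: operator_simps[OF rep_operator] rep_mult inv_mult_group rep_inv)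
    finally show ?thesis ..
  qed
  then obtain a where a: "\<And>v. ?T v = a *s v" using schur[OF T] by blast
  have "trace_op (?c x) = trace_op A" if x: "x \<in> carrier G" for x
    using trace_op_commute[OF rep_operator[of "inv x"] operator_comp[OF A rep_operator[OF x]]] x
    by (simp add: rep_inv)
  then have "of_nat (card (carrier G)) * trace_op A = trace_op ?T"
    by (simp add: trace_op_sum)
  also have "\<dots> = a * of_nat (dim (UNIV :: 'v set))"
    by (simp only: a trace_op_scaling)
  finally have *: "of_nat (card (carrier G)) * trace_op A = a * of_nat (dim (UNIV :: 'v set))" .
  then show ?thesis using dim_UNIV_nonzero by (simp add: a *)
qed

end

section \<open>Compression of the representation to a subspace\<close>

text \<open>The factor \<open>s\<close> stands for sqrt (d_rho / d_psi). It enters only as a real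
  number with prescribed square, which keeps square roots out of the algebra.\<close>

locale compressed_irrep = irreducible_unitary_rep scale Basis cinner G \<rho>
  for scale :: "complex \<Rightarrow> 'v::ab_group_add \<Rightarrow> 'v" (infixr \<open>*s\<close> 75)
    and Basis :: "'v set" and cinner :: "'v \<Rightarrow> 'v \<Rightarrow> complex"
    and G :: "('g, 'b) monoid_scheme" (structure) and \<rho> :: "'g \<Rightarrow> 'v \<Rightarrow> 'v" +
  fixes W :: "'v set" and P :: "'v \<Rightarrow> 'v" and s :: complex and \<psi> :: "'g \<Rightarrow> 'v \<Rightarrow> 'v"
  assumes W: "subspace W" and proj: "orthogonal_projection_onto W P"
    and cnj_s: "cnj s = s"
    and s_sq: "s * s * of_nat (dim W) = of_nat (dim (UNIV :: 'v set))"
    and dim_W: "dim W \<ge> 1"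
    and \<psi>: "x \<in> carrier G \<Longrightarrow> \<psi> x = (\<lambda>v. s *s P (\<rho> x (P v)))"
begin

abbreviation N :: complex where "N \<equiv> of_nat (card (carrier G))"

lemmas P_operator = projection_operator[OF W proj]
lemmas P_simps = operator_simps[OF P_operator]
lemmas rep_simps = operator_simps[OF rep_operator]

lemma P_idem: "P (P v) = P v"
  by (intro projection_id[OF W proj] projection_in[OF W proj])

lemma N_nonzero: "N \<noteq> 0"
  using fin by auto

lemma s_nonzero: "s \<noteq> 0"
  using s_sq dim_W dim_UNIV_nonzero by auto

text \<open>The normalisation of \<open>\<psi>\<close> is made for this: \<open>s * s\<close>
  cancels the ratio of dimensions in the scalar from \<open>sum_conjugates\<close>.\<close>

lemma s_twirl: "s * s * (N * of_nat (dim W) / of_nat (dim (UNIV :: 'v set))) = N"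
  using s_sq dim_UNIV_nonzero by (simp add: field_simps)

text \<open>A linear \<open>L\<close> factors out of the sum and leaves the conjugates of
  \<open>P\<close>. It stays general to cover the different operators that stand to the left of the
  conjugate in the expansions below.\<close>

lemma sum_twirl:
  assumes "operator L"
  shows "(s * s) *s (\<Sum>x\<in>carrier G. L (\<rho> (inv x) (P (\<rho> x v)))) = N *s L v"
proof -
  have "(s * s) *s (\<Sum>x\<in>carrier G. L (\<rho> (inv x) (P (\<rho> x v))))
      = (s * s) *s L (\<Sum>x\<in>carrier G. \<rho> (inv x) (P (\<rho> x v)))"
    by (simp add: operator_simps[OF assms])
  also have "\<dots> = N *s L v"
    unfolding sum_conjugates[OF P_operator] trace_projection[OF W proj]
    by (simp only: operator_simps[OF assms] scale_scale s_twirl)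
  finally show ?thesis .
qed

lemma psi_operator: "x \<in> carrier G \<Longrightarrow> operator (\<psi> x)"
  using operator_scale[OF operator_comp[OF P_operator operator_comp[OF rep_operator P_operator]]]
  by (simp add: \<psi>)

lemma psi_adjoint: "x \<in> carrier G \<Longrightarrow> cinner (\<psi> (inv x) v) w = cinner v (\<psi> x w)"
  by (simp add: \<psi> cinner_scale_left cinner_scale_right cnj_s
      projection_self_adjoint[OF W proj] rep_adjoint)

lemma adjoint_op_psi: "x \<in> carrier G \<Longrightarrow> adjoint_op (\<psi> x) = \<psi> (inv x)"
  by (intro adjoint_op_eqI psi_operator psi_adjoint inv_closed)

lemma sum_psi_inv_psi: "(\<Sum>x\<in>carrier G. \<psi> (inv x) (\<psi> x v)) = N *s P v"
proof -
  have "(\<Sum>x\<in>carrier G. \<psi> (inv x) (\<psi> x v))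
      = (s * s) *s (\<Sum>x\<in>carrier G. P (\<rho> (inv x) (P (\<rho> x (P v)))))"
    by (simp add: \<psi> P_simps rep_simps P_idem scale_sum_right)
  also have "\<dots> = N *s P (P v)" by (rule sum_twirl[OF P_operator])
  finally show ?thesis by (simp add: P_idem)
qed

section \<open>The multiplicativity defect\<close>

definition defect :: "'g \<Rightarrow> 'g \<Rightarrow> 'v \<Rightarrow> 'v"
  where "defect x y v = \<psi> (x \<otimes> y) v - \<psi> x (\<psi> y v)"

definition defect_adj :: "'g \<Rightarrow> 'g \<Rightarrow> 'v \<Rightarrow> 'v"
  where "defect_adj x y v = \<psi> (inv (x \<otimes> y)) v - \<psi> (inv y) (\<psi> (inv x) v)"

lemma adjoint_op_defect:
  assumes "x \<in> carrier G" and "y \<in> carrier G"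
  shows "adjoint_op (defect x y) = defect_adj x y"
proof (rule adjoint_op_eqI)
  show "operator (defect_adj x y)"
    unfolding defect_adj_def
    using assms by (intro operator_diff operator_comp[OF psi_operator psi_operator] psi_operator) auto
  show "cinner (defect_adj x y v) w = cinner v (defect x y w)" for v w
    using assms by (simp add: defect_def defect_adj_def cinner_diff_left cinner_diff_right psi_adjoint)
qed

text \<open>For fixed y, each of the four terms of the expansion contains x only through a conjugate
  of \<open>P\<close>, so \<open>sum_twirl\<close> removes it.\<close>

lemma sum_defect_x:
  assumes y: "y \<in> carrier G"
  shows "(\<Sum>x\<in>carrier G. defect_adj x y (defect x y v))
    = N *s (P v - (2 / s) *s \<psi> (inv y) (\<psi> y v) + \<psi> (inv y) (\<psi> y v))"
proof -
  let ?r = "\<lambda>v. P (\<rho> (inv y) v)"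
  \<comment> \<open>The left operator is \<open>?r\<close> for terms starting with the adjoint of
    \<open>\<psi> (x \<otimes> y)\<close>, and \<open>?r\<close> after \<open>P\<close> for those
    starting with the adjoint of the product.\<close>
  let ?t = "\<lambda>L x v. (s * s) *s L (\<rho> (inv x) (P (\<rho> x v)))"
  have r: "operator ?r"
    using operator_comp[OF P_operator rep_operator] y by simp
  then have rP: "operator (\<lambda>v. ?r (P v))" by (rule operator_comp[OF _ P_operator])
  have "(\<Sum>x\<in>carrier G. defect_adj x y (defect x y v))
      = (\<Sum>x\<in>carrier G. ?t ?r x (\<rho> y (P v)) - s *s ?t ?r x (P (\<rho> y (P v)))
          - s *s ?t (\<lambda>v. ?r (P v)) x (\<rho> y (P v))
          + (s * s) *s ?t (\<lambda>v. ?r (P v)) x (P (\<rho> y (P v))))"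
    using y by (intro sum.cong refl) (simp add: defect_def defect_adj_def \<psi> P_simps rep_simps P_idem
      rep_mult inv_mult_group scale_right_diff_distrib mult_ac)
  also have "\<dots> = N *s ?r (\<rho> y (P v)) - s *s N *s ?r (P (\<rho> y (P v)))
      - s *s N *s ?r (P (\<rho> y (P v))) + (s * s) *s N *s ?r (P (P (\<rho> y (P v))))"
    unfolding sum.distrib sum_subtractf scale_sum_right[symmetric] sum_twirl[OF r] sum_twirl[OF rP] ..
  \<comment> \<open>Each cross term carries -s times P \<open>\<rho> (inv y)\<close> P
    \<open>\<rho> y\<close> P, which is s^-2 times \<open>\<psi> (inv y)\<close>
    \<open>\<psi> y\<close>; together they give -2/s.\<close>
  also have "\<dots> = N *s (P v - (2 / s) *s \<psi> (inv y) (\<psi> y v) + \<psi> (inv y) (\<psi> y v))"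
    using y s_nonzero scale_left_distrib[of s s]
    by (simp add: \<psi> P_simps rep_simps P_idem rep_inv scale_right_diff_distrib
      scale_right_distrib mult_ac)
  finally show ?thesis .
qed

lemma sum_defect:
  "(\<Sum>(x, y)\<in>carrier G \<times> carrier G. defect_adj x y (defect x y v)) = (N * N * (2 - 2 / s)) *s P v"
proof -
  have "(\<Sum>(x, y)\<in>carrier G \<times> carrier G. defect_adj x y (defect x y v))
      = (\<Sum>y\<in>carrier G. \<Sum>x\<in>carrier G. defect_adj x y (defect x y v))"
    unfolding sum.cartesian_product[symmetric] by (rule sum.swap)
  \<comment> \<open>The remaining y-dependence is the sum evaluated in
    \<open>sum_psi_inv_psi\<close>.\<close>
  also have "\<dots> = N *s (N *s P v - (2 / s) *s N *s P v + N *s P v)"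
    by (simp add: sum_defect_x scale_sum_right[symmetric] sum.distrib sum_subtractf
        sum_psi_inv_psi sum_constant_scale)
  also have "\<dots> = (N * (N - 2 / s * N + N)) *s P v"
    by (simp only: scale_scale scale_left_distrib scale_left_diff_distrib scale_right_distrib
        scale_right_diff_distrib distrib_left right_diff_distrib)
  also have "N * (N - 2 / s * N + N) = N * N * (2 - 2 / s)" by (simp add: algebra_simps)
  finally show ?thesis .
qed

text \<open>The trace is taken after summation, where the operator is a multiple of \<open>P\<close>
  by \<open>sum_defect\<close>.\<close>

lemma sum_frobenius:
  "(\<Sum>(x, y)\<in>carrier G \<times> carrier G. frobenius_sq (defect x y))
    = Re (N * N * (2 - 2 / s) * of_nat (dim W))"
proof -
  have "(\<Sum>(x, y)\<in>carrier G \<times> carrier G. frobenius_sq (defect x y))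
      = Re (\<Sum>i\<in>carrier G \<times> carrier G. trace_op (\<lambda>v. case i of (x, y) \<Rightarrow> defect_adj x y (defect x y v)))"
    unfolding Re_sum
    by (rule sum.cong) (auto simp: frobenius_sq_def adjoint_op_defect o_def)
  also have "\<dots> = Re (trace_op (\<lambda>v. (N * N * (2 - 2 / s)) *s P v))"
    unfolding trace_op_sum[symmetric] sum_defect ..
  finally show ?thesis by (simp only: trace_op_scale trace_projection[OF W proj])
qed

lemma mean_psi_eq_0:
  assumes "\<exists>g\<in>carrier G. \<rho> g \<noteq> id"
  shows "mean_op (carrier G) \<psi> = (\<lambda>v. 0)"
proof
  fix v
  have "(\<Sum>x\<in>carrier G. \<psi> x v) = s *s P (\<Sum>x\<in>carrier G. \<rho> x (P v))"
    by (simp add: \<psi> P_simps scale_sum_right)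
  then show "mean_op (carrier G) \<psi> v = 0"
    by (simp add: mean_op_def sum_rep_eq_0[OF assms] P_simps)
qed

lemma mean_adjoint_psi_psi:
  "mean_op (carrier G) (\<lambda>x. adjoint_op (\<psi> x) \<circ> \<psi> x) = P"
  using N_nonzero by (auto simp: mean_op_def adjoint_op_psi sum_psi_inv_psi fun_eq_iff)

lemma mean_frobenius:
  "mean (carrier G \<times> carrier G) (\<lambda>(x, y). frobenius_sq (\<lambda>v. \<psi> (x \<otimes> y) v - \<psi> x (\<psi> y v)))
    = 2 * real (dim W) * (1 - Re (1 / s))"
proof -
  \<comment> \<open>All factors but the last are real, so \<open>Re\<close> acts on
    \<open>1 / s\<close> alone.\<close>
  have "N * N * (2 - 2 / s) * of_nat (dim W)
      = of_real (real (card (carrier G) * card (carrier G)) * (2 * real (dim W))) * (1 - 1 / s)"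
    by (simp add: algebra_simps)
  then have "Re (N * N * (2 - 2 / s) * of_nat (dim W))
      = real (card (carrier G) * card (carrier G)) * (2 * real (dim W)) * (1 - Re (1 / s))"
    by (simp only: times_complex.sel Re_complex_of_real Im_complex_of_real minus_complex.sel
        one_complex.sel)
  moreover have "(\<lambda>v. \<psi> (x \<otimes> y) v - \<psi> x (\<psi> y v)) = defect x y" for x y
    by (simp add: fun_eq_iff defect_def)
  moreover have "real (card (carrier G) * card (carrier G)) \<noteq> 0" using fin by auto
  ultimately show ?thesis
    by (simp only: mean_def sum_frobenius card_cartesian_product mult.assoc
        nonzero_mult_div_cancel_left not_False_eq_True)
qed

end

text \<open>The vanishing mean is stated for nontrivial \<open>\<rho>\<close>: if every
  \<open>\<rho> g\<close> is the identity, irreducibility forces dimension one, then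
  \<open>P\<close> is the identity and so is the mean of \<open>\<psi>\<close>.\<close>

theorem theorem4:
  fixes G :: "('g, 'b) monoid_scheme"
    and scale :: "complex \<Rightarrow> 'v::ab_group_add \<Rightarrow> 'v"
    and Basis :: "'v set"
    and cinner :: "'v \<Rightarrow> 'v \<Rightarrow> complex"
    and \<rho> \<psi> :: "'g \<Rightarrow> 'v \<Rightarrow> 'v"
    and P :: "'v \<Rightarrow> 'v"
    and W :: "'v set"
    and d_rho d_psi :: nat
  assumes "group G" and "finite (carrier G)"
    and "fin_dim_complex_inner_space scale Basis cinner"
    and "fin_dim_complex_inner_space.unitary_rep scale cinner G \<rho>"
    and "fin_dim_complex_inner_space.irreducible_rep scale G \<rho>"
    and "d_rho = vector_space.dim scale (UNIV :: 'v set)"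
    and "module.subspace scale W"
    and "d_psi = vector_space.dim scale W"
    and "d_psi \<ge> 1"
    and "fin_dim_complex_inner_space.orthogonal_projection_onto cinner W P"
    and "\<And>x. x \<in> carrier G \<Longrightarrow>
      \<psi> x = (\<lambda>v. scale (of_real (sqrt (real d_rho / real d_psi))) (P (\<rho> x (P v))))"
  shows "((\<exists>g\<in>carrier G. \<rho> g \<noteq> id) \<longrightarrow>
            fin_dim_complex_inner_space.mean_op scale (carrier G) \<psi> = (\<lambda>v. 0))
    \<and> fin_dim_complex_inner_space.mean_op scale (carrier G)
          (\<lambda>x. fin_dim_complex_inner_space.adjoint_op scale cinner (\<psi> x) \<circ> \<psi> x) = P
    \<and> mean (carrier G \<times> carrier G)
          (\<lambda>(x, y). fin_dim_complex_inner_space.frobenius_sq scale Basis cinner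
             (\<lambda>v. \<psi> (x \<otimes>\<^bsub>G\<^esub> y) v - \<psi> x (\<psi> y v)))
        = 2 * real d_psi * (1 - sqrt (real d_psi / real d_rho))"
proof -
  interpret fin_dim_complex_inner_space scale Basis cinner by fact
  interpret group G by fact
  interpret irreducible_unitary_rep scale Basis cinner G \<rho>
    using assms(2,4,5) by unfold_locales
  let ?r = "sqrt (real d_rho / real d_psi)"
  interpret compressed_irrep scale Basis cinner G \<rho> W P "of_real ?r" \<psi>
  proof
    \<comment> \<open>The square root is squared over the reals and the result is then transferred
      to the complex numbers.\<close>
    have "of_real (?r * ?r * real d_psi) = (of_real (real d_rho) :: complex)"
      using \<open>d_psi \<ge> 1\<close> by simp
    then have "of_real ?r * of_real ?r * of_nat d_psi = (of_nat d_rho :: complex)"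
      by (simp only: of_real_mult of_real_of_nat_eq)
    then show "of_real ?r * of_real ?r * of_nat (dim W) = (of_nat (dim (UNIV :: 'v set)) :: complex)"
      by (simp only: assms(6,8)[symmetric])
  qed (use assms in auto)
  have "Re (1 / of_real ?r) = sqrt (real d_psi / real d_rho)"
    by (simp add: real_sqrt_divide)
  then show ?thesis
    using mean_psi_eq_0 mean_adjoint_psi_psi mean_frobenius assms(8) by auto
qed

end
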